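(* Let $\mathcal{H}=\mathbb{R}^n$, let $t\in\mathbb{N}\smallsetminus\{0\}$, and let $F_1,\ldots,F_t$ be linear isometries on $\mathcal{H}$. Let $\Omega(F_1,\ldots,F_t)$ be the set of all finite compositions of operators from $\{F_1,\ldots,F_t\}$ (including the empty composition $\mathrm{Id}$), and let $\widetilde{\mathcal{S}}$ be a finite subset of $\Omega(F_1,\ldots,F_t)$ such that $\{\mathrm{Id},F_1,F_2F_1,\ldots,F_t\cdots F_2F_1\}\subseteq\widetilde{\mathcal{S}}$. Let $\omega_1,\ldots,\omega_t$ be real numbers in $]0,1]$ with $\sum_{i=1}^t\omega_i=1$, and let $\alpha_1,\ldots,\alpha_t$ and $\lambda_1,\ldots,\lambda_t$ be real numbers in $]0,1[$. Set $A:=\sum_{i=1}^t\omega_iA_i$, where $A_1:=(1-\alpha_1)\mathrm{Id}+\alpha_1F_1$ and, for every $i\in\{2,\ldots,t\}$, $A_i:=(1-\alpha_i)\mathrm{Id}+\alpha_i\big((1-\lambda_i)\mathrm{Id}+\lambda_iF_i\big)F_{i-1}\cdots F_1$. Then: (i) $\operatorname{Fix} CC_{\widetilde{\mathcal{S}}}=\bigcap_{T\in\widetilde{\mathcal{S}}}\operatorname{Fix}T=\bigcap_{i=1}^t\operatorname{Fix}F_i=\operatorname{Fix}A$. (ii) $\|A\,\mathrm{P}_{(\cap_{i=1}^t\operatorname{Fix}F_i)^\perp}\|\in[0,1[$, and for every $x\in\mathcal{H}$ and every $k\in\mathbb{N}$, $$\|CC_{\widetilde{\mathcal{S}}}^k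 x-\mathrm{P}_{\cap_{i=1}^t\operatorname{Fix}F_i}x\|\le\|A\,\mathrm{P}_{(\cap_{i=1}^t\operatorname{Fix}F_i)^\perp}\|^k\,\|x-\mathrm{P}_{\cap_{i=1}^t\operatorname{Fix}F_i}x\|.$$ Consequently, $(CC_{\widetilde{\mathcal{S}}}^kx)_{k\in\mathbb{N}}$ converges to $\mathrm{P}_{\cap_{i=1}^t\operatorname{Fix}F_i}x$ with linear rate $\|A\,\mathrm{P}_{(\cap_{i=1}^t\operatorname{Fix}F_i)^\perp}\|$.
   Context: $\mathbb{N}=\{0,1,2,\ldots\}$, and $\gamma^0=1$ also for $\gamma=0$. A map $T:\mathcal{H}\to\mathcal{H}$ is an isometry if $\|Tx-Ty\|=\|x-y\|$ for all $x,y\in\mathcal{H}$. $\operatorname{Fix}T=\{x: Tx=x\}$. $\mathrm{P}_C$ is the projector (best approximation operator) onto $C$; $C^\perp$ is the orthogonal complement; $\|\cdot\|$ of a linear operator is the operator norm. Circumcenter mapping: for a finite set $\mathcal{S}$ of isometries of $\mathcal{H}$ having a common fixed point, and $x\in\mathcal{H}$, let $\mathcal{S}(x)=\{Tx: T\in\mathcal{S}\}$. It is known that there is a unique point $CC_{\mathcal{S}}(x)$ that lies in the affine hull $\operatorname{aff}(\mathcal{S}(x))$ and is equidistant from all points of $\mathcal{S}(x)$; this defines the circumcenter mapping $CC_{\mathcal{S}}:\mathcal{H}\to\mathcal{H}$. $CC_{\mathcal{S}}^k$ is its $k$-fold composition. *)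

theory Defs
  imports "HOL-Analysis.Analysis"
begin

definition isometry :: "('a::real_normed_vector \<Rightarrow> 'a) \<Rightarrow> bool" where
  "isometry T \<longleftrightarrow> (\<forall>x y. norm (T x - T y) = norm (x - y))"

definition Fix :: "('a \<Rightarrow> 'a) \<Rightarrow> 'a set" where
  "Fix T = {x. T x = x}"

inductive_set compositions :: "('a \<Rightarrow> 'a) set \<Rightarrow> ('a \<Rightarrow> 'a) set"
  for \<F> :: "('a \<Rightarrow> 'a) set" where
  empty: "id \<in> compositions \<F>"
| step: "T \<in> compositions \<F> \<Longrightarrow> G \<in> \<F> \<Longrightarrow> G \<circ> T \<in> compositions \<F>"

text \<open>\<open>comp_upto F i\<close> is \<open>F i \<circ> \<dots> \<circ> F 2 \<circ> F 1\<close>; the value \<open>F 0\<close> plays no role.\<close>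

primrec comp_upto :: "(nat \<Rightarrow> 'a \<Rightarrow> 'a) \<Rightarrow> nat \<Rightarrow> 'a \<Rightarrow> 'a" where
  "comp_upto F 0 = id"
| "comp_upto F (Suc i) = F (Suc i) \<circ> comp_upto F i"

text \<open>The description below determines a unique point if \<open>S\<close> is a nonempty finite set of isometries
  with a common fixed point; for other \<open>S\<close> the value may be unspecified.\<close>

definition CC :: "('a::real_normed_vector \<Rightarrow> 'a) set \<Rightarrow> 'a \<Rightarrow> 'a" where
  "CC S x = (THE p. p \<in> affine hull ((\<lambda>T. T x) ` S) \<and>
     (\<forall>y \<in> (\<lambda>T. T x) ` S. \<forall>z \<in> (\<lambda>T. T x) ` S. dist p y = dist p z))"

definition converges_linearly :: "(nat \<Rightarrow> 'a::real_normed_vector) \<Rightarrow> 'a \<Rightarrow> real \<Rightarrow> bool" where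
  "converges_linearly X l \<gamma> \<longleftrightarrow> \<gamma> \<in> {0..<1} \<and> X \<longlonglongrightarrow> l \<and>
     (\<exists>C\<ge>0. \<forall>k. norm (X k - l) \<le> C * \<gamma> ^ k)"

end

theory Submission
  imports Defs
begin

text \<open>
  Let \<open>M\<close> be the set of common fixed points of the \<open>F i\<close>; every composition of the \<open>F i\<close>, and hence
  every \<open>T \<in> S\<close>, fixes \<open>M\<close> pointwise. Since \<open>T \<in> S\<close> is an isometry, a point \<open>z \<in> M\<close> has the same
  distance from all the points \<open>T x\<close>. By Pythagoras, its projection onto the affine hull of these
  points is equidistant from them too, so this projection is the circumcenter
  (\<open>CC_eq_closest_point\<close>). Thus the circumcenter is, among all points of the affine hull of \<open>S(x)\<close>,
  the closest one to \<open>z\<close>, simultaneously for all \<open>z \<in> M\<close>. As \<open>A x\<close> is a convex combination of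
  points of \<open>S(x)\<close>, this gives \<open>norm (CC S x - z) \<le> norm (A x - z)\<close>: the circumcenter mapping
  approaches \<open>M\<close> at least as fast as the linear map \<open>A\<close>.

  Take for \<open>z\<close> the projection of \<open>x\<close> onto \<open>M\<close>. The operator \<open>A\<close> fixes \<open>z\<close> and \<open>x - z\<close> is
  orthogonal to \<open>M\<close>, so \<open>norm (A x - z) \<le> \<gamma> * norm (x - z)\<close> where \<open>\<gamma>\<close> is the norm of \<open>A\<close>
  composed with the projection onto the orthogonal complement of \<open>M\<close>. All points of the affine hull of
  \<open>S(x)\<close> have the same projection onto \<open>M\<close>, so the estimate can be iterated
  (\<open>norm_CC_funpow_le\<close>).

  Finally \<open>\<gamma> < 1\<close>: by compactness it is enough that \<open>A\<close> shortens every vector outside \<open>M\<close>, and this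
  is strict convexity of the norm. If \<open>norm (A x) = norm x\<close>, no average that enters \<open>A\<close> shortens
  \<open>x\<close>, so the vectors averaged coincide; going through the \<open>A_i\<close> in order gives
  \<open>F 1 x = x\<close>, then \<open>F 2 x = x\<close>, and so on (\<open>averaged_operator_expansive_imp_fixed\<close>).
\<close>

section \<open>Projections onto affine sets and linear subspaces\<close>

text \<open>The variational inequality for the projection \<open>p\<close> holds at \<open>y\<close> and at the reflection of \<open>y\<close>
  in \<open>p\<close>, which also belongs to an affine set; hence it is an equality.\<close>

lemma closest_point_affine_orthogonal:
  fixes V :: "'a::euclidean_space set"
  assumes "affine V" "y \<in> V"
  shows "(a - closest_point V a) \<bullet> (y - closest_point V a) = 0"
proof -
  let ?p = "closest_point V a"
  have V: "convex V" "closed V" "V \<noteq> {}"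
    using assms affine_imp_convex affine_closed by auto
  have "?p \<in> V" using V closest_point_in_set by auto
  then have "2 *\<^sub>R ?p + (- 1) *\<^sub>R y \<in> V" by (intro mem_affine assms) auto
  then have "(a - ?p) \<bullet> ((2 *\<^sub>R ?p + (- 1) *\<^sub>R y) - ?p) \<le> 0" using V closest_point_dot by blast
  moreover have "(2 *\<^sub>R ?p + (- 1) *\<^sub>R y) - ?p = - (y - ?p)" by (simp add: algebra_simps scaleR_2)
  ultimately have "(a - ?p) \<bullet> (y - ?p) \<ge> 0" by (metis inner_minus_right neg_le_0_iff_le)
  moreover have "(a - ?p) \<bullet> (y - ?p) \<le> 0" using V assms closest_point_dot by blast
  ultimately show ?thesis by simp
qed

lemma closest_point_affine_pythagoras:
  fixes V :: "'a::euclidean_space set"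
  assumes "affine V" "y \<in> V"
  shows "(dist a y)\<^sup>2 = (dist a (closest_point V a))\<^sup>2 + (dist (closest_point V a) y)\<^sup>2"
proof -
  let ?p = "closest_point V a"
  have "(norm (a - y))\<^sup>2 = (norm ((a - ?p) + - (y - ?p)))\<^sup>2" by simp
  also have "\<dots> = (norm (a - ?p))\<^sup>2 + (norm (- (y - ?p)))\<^sup>2"
    using closest_point_affine_orthogonal[OF assms, of a]
    by (intro norm_add_Pythagorean) (simp only: orthogonal_def inner_minus_right neg_equal_0_iff_equal)
  finally show ?thesis by (simp add: dist_norm norm_minus_commute)
qed

lemma closest_point_subspace:
  fixes M :: "'a::euclidean_space set"
  assumes "subspace M"
  shows closest_point_subspace_mem: "closest_point M x \<in> M"
    and closest_point_subspace_diff: "x - closest_point M x \<in> orthogonal_comp M"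
proof -
  let ?p = "closest_point M x"
  show p: "?p \<in> M"
    using assms closed_subspace subspace_0 by (intro closest_point_in_set) auto
  have "y \<bullet> (x - ?p) = 0" if "y \<in> M" for y
    using closest_point_affine_orthogonal[OF subspace_imp_affine[OF assms], of "y + ?p" x]
      subspace_add[OF assms that p] by (simp add: inner_commute)
  then show "x - ?p \<in> orthogonal_comp M" by (simp add: orthogonal_comp_def orthogonal_def)
qed

lemma closest_point_subspace_eqI:
  fixes M :: "'a::euclidean_space set"
  assumes M: "subspace M" and "p \<in> M" "x - p \<in> orthogonal_comp M"
  shows "closest_point M x = p"
proof -
  let ?q = "closest_point M x"
  have "?q - p \<in> M"
    using assms closest_point_subspace_mem[OF M] subspace_diff by blast
  moreover have "(x - p) - (x - ?q) \<in> orthogonal_comp M"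
    using assms closest_point_subspace_diff[OF M] subspace_orthogonal_comp by (blast intro: subspace_diff)
  then have "?q - p \<in> orthogonal_comp M" by simp
  ultimately have "(?q - p) \<bullet> (?q - p) = 0"
    by (auto simp: orthogonal_comp_def orthogonal_def)
  then show ?thesis by simp
qed

lemma linear_closest_point_subspace:
  fixes M :: "'a::euclidean_space set"
  assumes M: "subspace M"
  shows "linear (closest_point M)"
proof (rule linearI)
  fix x y :: 'a and c :: real
  note mem = closest_point_subspace_mem[OF M] and diff = closest_point_subspace_diff[OF M]
  have "(x - closest_point M x) + (y - closest_point M y) \<in> orthogonal_comp M"
    by (intro subspace_add subspace_orthogonal_comp diff)
  then show "closest_point M (x + y) = closest_point M x + closest_point M y"
    by (intro closest_point_subspace_eqI[OF M] subspace_add[OF M] mem) (simp add: algebra_simps)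
  have "c *\<^sub>R (x - closest_point M x) \<in> orthogonal_comp M"
    by (intro subspace_scale subspace_orthogonal_comp diff)
  then show "closest_point M (c *\<^sub>R x) = c *\<^sub>R closest_point M x"
    by (intro closest_point_subspace_eqI[OF M] subspace_scale[OF M] mem) (simp add: algebra_simps)
qed

lemma norm_closest_point_subspace_le:
  fixes M :: "'a::euclidean_space set"
  assumes M: "subspace M"
  shows "norm (closest_point M x) \<le> norm x"
proof -
  have "(norm x)\<^sup>2 = (norm (x - closest_point M x))\<^sup>2 + (norm (closest_point M x))\<^sup>2"
    using closest_point_affine_pythagoras[OF subspace_imp_affine[OF M] subspace_0[OF M], of x]
    by (simp add: dist_norm)
  then have "(norm (closest_point M x))\<^sup>2 \<le> (norm x)\<^sup>2" by simp
  then show ?thesis by (rule power2_le_imp_le) simp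
qed

section \<open>The circumcenter as a projection\<close>

lemma image_common_fixed_point:
  assumes "S \<noteq> {}" "\<And>T. T \<in> S \<Longrightarrow> T z = z"
  shows "(\<lambda>T. T z) ` S = {z}"
proof -
  have "(\<lambda>T. T z) ` S = (\<lambda>_. z) ` S" using assms(2) by (intro image_cong) auto
  also have "\<dots> = {z}" using assms(1) by auto
  finally show ?thesis .
qed

text \<open>Equidistance makes the difference of two candidates orthogonal to all differences of points of
  \<open>D\<close>, that is, constant as a linear form on the affine hull, to which both candidates belong.\<close>

lemma circumcenter_unique:
  fixes p q :: "'a::real_inner"
  assumes "p \<in> affine hull D" "\<forall>y\<in>D. \<forall>z\<in>D. dist p y = dist p z"
    and "q \<in> affine hull D" "\<forall>y\<in>D. \<forall>z\<in>D. dist q y = dist q z"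
  shows "p = q"
proof -
  obtain d where d: "d \<in> D" using assms(1) by (cases "D = {}") auto
  have "(p - q) \<bullet> y = (p - q) \<bullet> d" if "y \<in> D" for y
  proof -
    have "(norm (p - y))\<^sup>2 = (norm (p - d))\<^sup>2" "(norm (q - y))\<^sup>2 = (norm (q - d))\<^sup>2"
      using assms(2,4) that d unfolding dist_norm by metis+
    then show ?thesis
      unfolding power2_norm_eq_inner by (simp add: inner_simps inner_commute)
  qed
  then have "D \<subseteq> {y. (p - q) \<bullet> y = (p - q) \<bullet> d}" by auto
  then have "affine hull D \<subseteq> {y. (p - q) \<bullet> y = (p - q) \<bullet> d}"
    by (intro hull_minimal affine_hyperplane)
  then have "(p - q) \<bullet> p = (p - q) \<bullet> d" "(p - q) \<bullet> q = (p - q) \<bullet> d" using assms(1,3) by blast+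
  then have "(p - q) \<bullet> (p - q) = 0" by (simp add: inner_diff_right)
  then show ?thesis by simp
qed

text \<open>A common fixed point \<open>z\<close> is equidistant from all \<open>T x\<close>, and projecting onto the affine hull
  lowers all the squared distances by the same amount.\<close>

lemma CC_eq_closest_point:
  fixes z :: "'a::euclidean_space"
  assumes "S \<noteq> {}" and isom: "\<And>T. T \<in> S \<Longrightarrow> isometry T" and fixed: "\<And>T. T \<in> S \<Longrightarrow> T z = z"
  shows "CC S x = closest_point (affine hull ((\<lambda>T. T x) ` S)) z"
proof -
  let ?D = "(\<lambda>T. T x) ` S"
  let ?p = "closest_point (affine hull ?D) z"
  have p: "?p \<in> affine hull ?D"
    using assms(1) by (intro closest_point_in_set) auto
  have z: "dist z y = dist z x" if "y \<in> ?D" for y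
    using that isom fixed unfolding isometry_def dist_norm by auto metis
  have "dist ?p y = dist ?p y'" if "y \<in> ?D" "y' \<in> ?D" for y y'
  proof -
    have "(dist ?p y)\<^sup>2 = (dist ?p y')\<^sup>2"
      using closest_point_affine_pythagoras[OF affine_affine_hull hull_inc[OF that(1)], of z]
        closest_point_affine_pythagoras[OF affine_affine_hull hull_inc[OF that(2)], of z]
        z[OF that(1)] z[OF that(2)] by simp
    then show ?thesis by simp
  qed
  then have eq: "\<forall>y\<in>?D. \<forall>y'\<in>?D. dist ?p y = dist ?p y'" by blast
  show ?thesis
    unfolding CC_def
    by (rule the_equality) (use p eq circumcenter_unique in blast)+
qed

text \<open>This is what makes the circumcenter mapping at least as good as any explicit algorithm whose
  steps stay in the affine hulls of the sets \<open>S(x)\<close>.\<close>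

lemma norm_CC_diff_le:
  fixes z :: "'a::euclidean_space"
  assumes "\<And>T. T \<in> S \<Longrightarrow> isometry T" "\<And>T. T \<in> S \<Longrightarrow> T z = z"
    and y: "y \<in> affine hull ((\<lambda>T. T x) ` S)"
  shows "norm (CC S x - z) \<le> norm (y - z)"
proof -
  have "S \<noteq> {}" using y by auto
  then show ?thesis
    using CC_eq_closest_point[of S z x] assms closest_point_le[OF closed_affine_hull y, of z]
    by (simp add: dist_norm norm_minus_commute)
qed

text \<open>The points \<open>x\<close> and \<open>T x\<close> have the same distance from \<open>z\<close>. If \<open>x\<close> is its own circumcenter,
  it is the projection of \<open>z\<close>, and Pythagoras leaves no distance between \<open>x\<close> and \<open>T x\<close>.\<close>

lemma Fix_CC:
  fixes S :: "('a::euclidean_space \<Rightarrow> 'a) set"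
  assumes "S \<noteq> {}" and isom: "\<And>T. T \<in> S \<Longrightarrow> isometry T" and z: "\<And>T. T \<in> S \<Longrightarrow> T z = z"
  shows "Fix (CC S) = (\<Inter>T\<in>S. Fix T)"
proof (intro set_eqI iffI)
  fix x assume "x \<in> Fix (CC S)"
  let ?V = "affine hull ((\<lambda>T. T x) ` S)"
  have x: "closest_point ?V z = x"
    using \<open>x \<in> Fix (CC S)\<close> CC_eq_closest_point[of S z x] assms by (fastforce simp: Fix_def)
  have "T x = x" if "T \<in> S" for T
  proof -
    have "dist z (T x) = dist z x"
      using isom[OF that] z[OF that] unfolding isometry_def dist_norm by metis
    moreover have "T x \<in> ?V" using that by (simp add: hull_inc)
    then have "(dist z (T x))\<^sup>2 = (dist z x)\<^sup>2 + (dist x (T x))\<^sup>2"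
      using closest_point_affine_pythagoras[OF affine_affine_hull, of "T x" _ z] x by metis
    ultimately show ?thesis by simp
  qed
  then show "x \<in> (\<Inter>T\<in>S. Fix T)" by (auto simp: Fix_def)
next
  fix x assume "x \<in> (\<Inter>T\<in>S. Fix T)"
  then have fixed: "T x = x" if "T \<in> S" for T using that by (auto simp: Fix_def)
  have "(\<lambda>T. T x) ` S = {x}" using \<open>S \<noteq> {}\<close> fixed by (rule image_common_fixed_point)
  then have "x \<in> affine hull ((\<lambda>T. T x) ` S)" by simp
  then have "norm (CC S x - x) \<le> norm (x - x)"
    by (intro norm_CC_diff_le isom fixed)
  then show "x \<in> Fix (CC S)" by (simp add: Fix_def)
qed

section \<open>Linear convergence of the circumcenter iteration\<close>

text \<open>A linear isometry that fixes \<open>M\<close> pointwise moves every point along the orthogonal complement of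
  \<open>M\<close>, and so does every affine combination of such isometries.\<close>

lemma affine_hull_isometries_diff_orthogonal:
  fixes S :: "('a::real_inner \<Rightarrow> 'a) set"
  assumes isom: "\<And>T. T \<in> S \<Longrightarrow> linear T \<and> isometry T" and fixed: "\<And>T z. T \<in> S \<Longrightarrow> z \<in> M \<Longrightarrow> T z = z"
    and y: "y \<in> affine hull ((\<lambda>T. T x) ` S)"
  shows "y - x \<in> orthogonal_comp M"
proof -
  have "z \<bullet> (y - x) = 0" if z: "z \<in> M" for z
  proof -
    have "z \<bullet> T x = z \<bullet> x" if T: "T \<in> S" for T
    proof -
      have "norm (T v) = norm v" for v
        using isom[OF T] linear_0[of T] unfolding isometry_def by (metis diff_zero)
      moreover have "norm (z - T x) = norm (z - x)"
        using isom[OF T] fixed[OF T z] unfolding isometry_def by metis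
      ultimately show ?thesis by (simp add: dot_norm_neg)
    qed
    then have "(\<lambda>T. T x) ` S \<subseteq> {w. z \<bullet> w = z \<bullet> x}" by auto
    then have "affine hull ((\<lambda>T. T x) ` S) \<subseteq> {w. z \<bullet> w = z \<bullet> x}"
      by (intro hull_minimal affine_hyperplane)
    then show ?thesis using y by (auto simp: inner_diff_right)
  qed
  then show ?thesis by (simp add: orthogonal_comp_def orthogonal_def)
qed

text \<open>One step of the circumcenter mapping is compared with one step of \<open>A\<close>, both measured from the
  projection of the current point onto \<open>M\<close>. The steps can be chained because this projection does
  not change along the iteration.\<close>

lemma norm_CC_funpow_le:
  fixes S :: "('a::euclidean_space \<Rightarrow> 'a) set" and A :: "'a \<Rightarrow> 'a"
  assumes M: "subspace M"
    and isom: "\<And>T. T \<in> S \<Longrightarrow> linear T \<and> isometry T" and fixed: "\<And>T z. T \<in> S \<Longrightarrow> z \<in> M \<Longrightarrow> T z = z"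
    and A: "linear A" "\<And>x. A x \<in> affine hull ((\<lambda>T. T x) ` S)"
  defines "\<gamma> \<equiv> onorm (A \<circ> closest_point (orthogonal_comp M))"
  shows "norm ((CC S ^^ k) x - closest_point M x) \<le> \<gamma> ^ k * norm (x - closest_point M x)"
proof -
  let ?P = "closest_point M" and ?Q = "closest_point (orthogonal_comp M)"
  have ne: "S \<noteq> {}" using A(2)[of 0] by auto
  have bl: "bounded_linear (A \<circ> ?Q)"
    unfolding linear_conv_bounded_linear[symmetric]
    by (intro linear_compose linear_closest_point_subspace subspace_orthogonal_comp A(1))
  have fixed_P: "T (?P x) = ?P x" if "T \<in> S" for T x
    using that closest_point_subspace_mem[OF M] by (rule fixed)
  have CC_step: "norm (CC S x - ?P x) \<le> \<gamma> * norm (x - ?P x)" for x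
  proof -
    (* A fixes M pointwise, since the affine hull in question degenerates to a point. *)
    have "(\<lambda>T. T (?P x)) ` S = {?P x}"
      by (rule image_common_fixed_point[OF ne]) (rule fixed_P)
    then have "A (?P x) = ?P x" using A(2)[of "?P x"] by simp
    then have "A x - ?P x = A (x - ?P x)" using linear_diff[OF A(1)] by simp
    also have "\<dots> = (A \<circ> ?Q) (x - ?P x)"
      using closest_point_self[OF closest_point_subspace_diff[OF M]] by simp
    finally have "norm (A x - ?P x) \<le> \<gamma> * norm (x - ?P x)"
      using onorm[OF bl] unfolding \<gamma>_def by metis
    moreover have "norm (CC S x - ?P x) \<le> norm (A x - ?P x)"
      by (rule norm_CC_diff_le[OF _ _ A(2)]) (use isom fixed_P in blast)+
    ultimately show ?thesis by linarith
  qed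
  have P_CC: "?P (CC S x) = ?P x" for x
  proof (rule closest_point_subspace_eqI[OF M closest_point_subspace_mem[OF M]])
    (* Projecting the common fixed point 0 of linear maps places the circumcenter in the affine hull. *)
    have "CC S x = closest_point (affine hull ((\<lambda>T. T x) ` S)) 0"
      by (rule CC_eq_closest_point[OF ne]) (use isom linear_0 in blast)+
    then have "CC S x \<in> affine hull ((\<lambda>T. T x) ` S)"
      using ne closest_point_in_set[of "affine hull ((\<lambda>T. T x) ` S)" 0] by auto
    then have "CC S x - x \<in> orthogonal_comp M"
      by (rule affine_hull_isometries_diff_orthogonal[where M = M, rotated 2]) (use isom fixed in blast)+
    then have "(CC S x - x) + (x - ?P x) \<in> orthogonal_comp M"
      by (intro subspace_add subspace_orthogonal_comp closest_point_subspace_diff[OF M])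
    then show "CC S x - ?P x \<in> orthogonal_comp M" by simp
  qed
  have P_pow: "?P ((CC S ^^ k) x) = ?P x" for k by (induction k) (simp_all add: P_CC)
  have "\<gamma> \<ge> 0" unfolding \<gamma>_def by (rule onorm_pos_le[OF bl])
  show ?thesis
  proof (induction k)
    case (Suc k)
    have "norm ((CC S ^^ Suc k) x - ?P x) \<le> \<gamma> * norm ((CC S ^^ k) x - ?P x)"
      using CC_step[of "(CC S ^^ k) x"] P_pow by simp
    also have "\<dots> \<le> \<gamma> * (\<gamma> ^ k * norm (x - ?P x))"
      using Suc.IH \<open>\<gamma> \<ge> 0\<close> by (rule mult_left_mono)
    finally show ?case by (simp add: mult.assoc)
  qed simp
qed

section \<open>The averaged operator shortens vectors outside the fixed point space\<close>

text \<open>Compactness of the unit sphere: the operator norm is attained at some unit vector \<open>u\<close>. A value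
  of at least \<open>1\<close> would prevent \<open>A\<close> from shortening the projection of \<open>u\<close>, which would then lie
  in \<open>M\<close> and be orthogonal to \<open>M\<close>.\<close>

lemma onorm_compose_orthogonal_projection_less_1:
  fixes A :: "'a::euclidean_space \<Rightarrow> 'a"
  assumes A: "linear A" and M: "\<And>x. norm x \<le> norm (A x) \<Longrightarrow> x \<in> M"
  shows "onorm (A \<circ> closest_point (orthogonal_comp M)) < 1"
proof -
  let ?Q = "closest_point (orthogonal_comp M)"
  note sub = subspace_orthogonal_comp[of M]
  have lin: "linear (A \<circ> ?Q)" by (intro linear_compose linear_closest_point_subspace sub A)
  have "continuous_on (sphere 0 1) (\<lambda>x. norm ((A \<circ> ?Q) x))"
    using lin linear_continuous_on[of "A \<circ> ?Q"]
    by (intro continuous_on_norm) (simp add: linear_conv_bounded_linear)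
  moreover have "sphere (0::'a) 1 \<noteq> {}" by simp
  ultimately obtain u where u: "norm u = 1"
    and max: "\<And>x. norm x = 1 \<Longrightarrow> norm ((A \<circ> ?Q) x) \<le> norm ((A \<circ> ?Q) u)"
    using continuous_attains_sup[OF compact_sphere] by (metis mem_sphere_0)
  have "onorm (A \<circ> ?Q) \<le> norm (A (?Q u))"
  proof (rule onorm_le)
    fix x :: 'a
    show "norm ((A \<circ> ?Q) x) \<le> norm (A (?Q u)) * norm x"
    proof (cases "x = 0")
      case True
      then show ?thesis using linear_0[OF lin] by simp
    next
      case False
      then have "norm ((A \<circ> ?Q) ((1 / norm x) *\<^sub>R x)) \<le> norm ((A \<circ> ?Q) u)" by (intro max) simp
      then show ?thesis
        unfolding linear_cmul[OF lin] using False by (simp add: field_simps)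
    qed
  qed
  also have "\<dots> < 1"
  proof (rule ccontr)
    assume "\<not> norm (A (?Q u)) < 1"
    moreover have "norm (?Q u) \<le> 1" using norm_closest_point_subspace_le[OF sub, of u] u by simp
    ultimately have "?Q u \<in> M" by (intro M) simp
    moreover have "?Q u \<in> orthogonal_comp M" by (rule closest_point_subspace_mem[OF sub])
    ultimately have "?Q u \<bullet> ?Q u = 0" by (simp add: orthogonal_comp_def orthogonal_def)
    then show False using \<open>\<not> norm (A (?Q u)) < 1\<close> linear_0[OF A] by simp
  qed
  finally show ?thesis .
qed

lemma norm_convex_combination_eq_imp_eq:
  fixes x y :: "'a::real_inner"
  assumes a: "0 < a" "a < 1" and "norm x \<le> c" "norm y \<le> c"
    and ge: "c \<le> norm ((1 - a) *\<^sub>R x + a *\<^sub>R y)"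
  shows "x = y"
proof -
  have "0 \<le> c" using assms(3) norm_ge_zero order_trans by blast
  have "(norm ((1 - a) *\<^sub>R x + a *\<^sub>R y))\<^sup>2 =
      (1 - a) * (norm x)\<^sup>2 + a * (norm y)\<^sup>2 - a * (1 - a) * (norm (x - y))\<^sup>2"
    unfolding power2_norm_eq_inner
    by (simp add: inner_simps inner_commute[of y x] algebra_simps)
  moreover have "(1 - a) * (norm x)\<^sup>2 + a * (norm y)\<^sup>2 \<le> c\<^sup>2"
    using assms by (intro convex_bound_le power_mono) auto
  moreover have "c\<^sup>2 \<le> (norm ((1 - a) *\<^sub>R x + a *\<^sub>R y))\<^sup>2" using ge \<open>0 \<le> c\<close> by (rule power_mono)
  ultimately have "a * (1 - a) * (norm (x - y))\<^sup>2 \<le> 0" by linarith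
  then show ?thesis using a by (simp add: mult_le_0_iff)
qed

lemma comp_upto_fixed:
  assumes "\<And>j. j \<in> {1..i} \<Longrightarrow> F j x = x"
  shows "comp_upto F i x = x"
  using assms by (induction i) auto

lemma linear_norm_preserving_comp_upto:
  fixes F :: "nat \<Rightarrow> 'a::real_normed_vector \<Rightarrow> 'a"
  assumes "\<And>j. j \<in> {1..i} \<Longrightarrow> linear (F j) \<and> (\<forall>x. norm (F j x) = norm x)"
  shows "linear (comp_upto F i) \<and> (\<forall>x. norm (comp_upto F i x) = norm x)"
  using assms
proof (induction i)
  case (Suc i)
  then have "linear (comp_upto F i) \<and> (\<forall>x. norm (comp_upto F i x) = norm x)" by simp
  then show ?case using Suc.prems[of "Suc i"] linear_compose[of "comp_upto F i" "F (Suc i)"]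
    by (simp add: o_def)
qed (simp add: linear_id)

text \<open>The operator \<open>A_i i\<close> without the case distinction: for \<open>i = 1\<close> it is the general expression
  with relaxation parameter \<open>1\<close>, because \<open>comp_upto F 0\<close> is the identity.\<close>

definition averaged_summand ::
    "(nat \<Rightarrow> 'a::real_vector \<Rightarrow> 'a) \<Rightarrow> (nat \<Rightarrow> real) \<Rightarrow> (nat \<Rightarrow> real) \<Rightarrow> nat \<Rightarrow> 'a \<Rightarrow> 'a" where
  "averaged_summand F \<alpha> \<mu> i x = (1 - \<alpha> i) *\<^sub>R x
     + \<alpha> i *\<^sub>R ((1 - \<mu> i) *\<^sub>R comp_upto F (i - 1) x + \<mu> i *\<^sub>R F i (comp_upto F (i - 1) x))"

lemma convex_averaged_summand:
  assumes "convex C" "0 \<le> \<alpha> i" "\<alpha> i \<le> 1" "0 \<le> \<mu> i" "\<mu> i \<le> 1"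
    and "x \<in> C" "comp_upto F (i - 1) x \<in> C" "F i (comp_upto F (i - 1) x) \<in> C"
  shows "averaged_summand F \<alpha> \<mu> i x \<in> C"
  unfolding averaged_summand_def using assms by (intro convexD[OF assms(1)]) auto

text \<open>Nothing is lost in the triangle inequality, so each summand preserves the norm of \<open>x\<close>. Once
  \<open>F 1, \<dots>, F (i - 1)\<close> are known to fix \<open>x\<close>, the summand with index \<open>i\<close> is a proper average of \<open>x\<close> and
  \<open>F i x\<close>, which then must be equal.\<close>

lemma averaged_operator_expansive_imp_fixed:
  fixes F :: "nat \<Rightarrow> 'a::real_inner \<Rightarrow> 'a"
  assumes F: "\<And>i. i \<in> {1..t} \<Longrightarrow> linear (F i) \<and> (\<forall>x. norm (F i x) = norm x)"
    and \<omega>: "\<And>i. i \<in> {1..t} \<Longrightarrow> 0 < \<omega> i" "(\<Sum>i=1..t. \<omega> i) = 1"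
    and \<alpha>: "\<And>i. i \<in> {1..t} \<Longrightarrow> 0 < \<alpha> i \<and> \<alpha> i < 1"
    and \<mu>: "\<And>i. i \<in> {1..t} \<Longrightarrow> 0 < \<mu> i \<and> \<mu> i \<le> 1"
    and ge: "norm x \<le> norm (\<Sum>i=1..t. \<omega> i *\<^sub>R averaged_summand F \<alpha> \<mu> i x)"
    and "i \<in> {1..t}"
  shows "F i x = x"
proof -
  let ?B = "averaged_summand F \<alpha> \<mu>"
  have le: "norm (?B i x) \<le> norm x" if i: "i \<in> {1..t}" for i
  proof -
    have "linear (comp_upto F (i - 1)) \<and> (\<forall>x. norm (comp_upto F (i - 1) x) = norm x)"
      by (rule linear_norm_preserving_comp_upto) (use F i in auto)
    then have "norm (comp_upto F (i - 1) x) = norm x" by simp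
    then have "?B i x \<in> cball 0 (norm x)"
      using F[OF i] \<alpha>[OF i] \<mu>[OF i] by (intro convex_averaged_summand) auto
    then show ?thesis by simp
  qed
  have B: "norm (?B i x) = norm x" if i: "i \<in> {1..t}" for i
  proof (rule ccontr)
    assume "norm (?B i x) \<noteq> norm x"
    then have "norm (?B i x) < norm x" using le[OF i] by simp
    have "norm (\<Sum>i=1..t. \<omega> i *\<^sub>R ?B i x) \<le> (\<Sum>i=1..t. norm (\<omega> i *\<^sub>R ?B i x))" by (rule norm_sum)
    also have "\<dots> = (\<Sum>i=1..t. \<omega> i * norm (?B i x))"
      using \<omega>(1) by (intro sum.cong) (auto simp: less_imp_le)
    also have "\<dots> < (\<Sum>i=1..t. \<omega> i * norm x)"
      using \<omega>(1) le \<open>norm (?B i x) < norm x\<close> i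
      by (intro sum_strict_mono_ex1) (auto intro!: mult_left_mono less_imp_le[of 0])
    also have "\<dots> = norm x" using \<omega>(2) by (simp flip: sum_distrib_right)
    finally show False using ge by simp
  qed
  show ?thesis
    using \<open>i \<in> {1..t}\<close>
  proof (induction i rule: less_induct)
    case (less i)
    have "comp_upto F (i - 1) x = x" using less by (intro comp_upto_fixed) auto
    then have "?B i x = (1 - \<alpha> i * \<mu> i) *\<^sub>R x + (\<alpha> i * \<mu> i) *\<^sub>R F i x"
      by (simp add: averaged_summand_def algebra_simps)
    then have "norm x \<le> norm ((1 - \<alpha> i * \<mu> i) *\<^sub>R x + (\<alpha> i * \<mu> i) *\<^sub>R F i x)"
      using B[OF less.prems] by simp
    moreover have "0 < \<alpha> i * \<mu> i" using \<alpha>[OF less.prems] \<mu>[OF less.prems] by simp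
    moreover have "\<alpha> i * \<mu> i < 1"
      using \<alpha>[OF less.prems] \<mu>[OF less.prems] mult_left_le[of "\<mu> i" "\<alpha> i"] by linarith
    ultimately have "x = F i x"
      using F[OF less.prems] by (intro norm_convex_combination_eq_imp_eq[of "\<alpha> i * \<mu> i" x "norm x"]) auto
    then show ?case by simp
  qed
qed

section \<open>Compositions and their common fixed points\<close>

lemma linear_isometry_compositions:
  assumes "T \<in> compositions \<F>" "\<And>G. G \<in> \<F> \<Longrightarrow> linear G \<and> isometry G"
  shows "linear T \<and> isometry T"
  using assms
  by induction (auto simp: isometry_def linear_id intro: linear_compose)

lemma compositions_fixed:
  assumes "T \<in> compositions \<F>" "\<And>G. G \<in> \<F> \<Longrightarrow> G x = x"
  shows "T x = x"
  using assms by induction auto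

lemma Inter_Fix_compositions:
  fixes t :: nat
  assumes "S \<subseteq> compositions (F ` {1..t})" "comp_upto F ` {0..t} \<subseteq> S"
  shows "(\<Inter>T\<in>S. Fix T) = (\<Inter>i\<in>{1..t}. Fix (F i))"
proof (intro equalityI subsetI INT_I)
  fix x i assume x: "x \<in> (\<Inter>T\<in>S. Fix T)" and i: "i \<in> {1..t}"
  have "comp_upto F j x = x" if "j \<le> t" for j
  proof -
    have "comp_upto F j \<in> S" using assms(2) that by auto
    then show ?thesis using x by (auto simp: Fix_def)
  qed
  from this[of i] this[of "i - 1"] have "comp_upto F (Suc (i - 1)) x = x" "comp_upto F (i - 1) x = x"
    using i by auto
  then show "x \<in> Fix (F i)" using i by (simp add: Fix_def)
next
  fix x T assume x: "x \<in> (\<Inter>i\<in>{1..t}. Fix (F i))" and T: "T \<in> S"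
  have "T \<in> compositions (F ` {1..t})" using T assms(1) by auto
  then have "T x = x" by (rule compositions_fixed) (use x in \<open>auto simp: Fix_def\<close>)
  then show "x \<in> Fix T" by (simp add: Fix_def)
qed

section \<open>Linear convergence of circumcenter mappings induced by linear isometries\<close>

theorem theorem5p6:
  fixes t :: nat
    and F A_i :: "nat \<Rightarrow> real ^ 'n \<Rightarrow> real ^ 'n"
    and A :: "real ^ 'n \<Rightarrow> real ^ 'n"
    and S :: "(real ^ 'n \<Rightarrow> real ^ 'n) set"
    and \<omega> \<alpha> l :: "nat \<Rightarrow> real"
  assumes "t \<noteq> 0"
    and "\<And>i. i \<in> {1..t} \<Longrightarrow> linear (F i) \<and> isometry (F i)"
    and "finite S"
    and "S \<subseteq> compositions (F ` {1..t})"
    and "comp_upto F ` {0..t} \<subseteq> S"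
    and "\<And>i. i \<in> {1..t} \<Longrightarrow> \<omega> i \<in> {0<..1}"
    and "(\<Sum>i=1..t. \<omega> i) = 1"
    and "\<And>i. i \<in> {1..t} \<Longrightarrow> \<alpha> i \<in> {0<..<1}"
    and "\<And>i. i \<in> {1..t} \<Longrightarrow> l i \<in> {0<..<1}"
    and "A_i 1 = (\<lambda>x. (1 - \<alpha> 1) *\<^sub>R x + \<alpha> 1 *\<^sub>R F 1 x)"
    and "\<And>i. i \<in> {2..t} \<Longrightarrow>
           A_i i = (\<lambda>x. (1 - \<alpha> i) *\<^sub>R x
             + \<alpha> i *\<^sub>R ((\<lambda>y. (1 - l i) *\<^sub>R y + l i *\<^sub>R F i y) \<circ> comp_upto F (i - 1)) x)"
    and "A = (\<lambda>x. \<Sum>i=1..t. \<omega> i *\<^sub>R A_i i x)"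
  shows "Fix (CC S) = (\<Inter>T\<in>S. Fix T)
       \<and> (\<Inter>T\<in>S. Fix T) = (\<Inter>i\<in>{1..t}. Fix (F i))
       \<and> (\<Inter>i\<in>{1..t}. Fix (F i)) = Fix A
       \<and> (let M = (\<Inter>i\<in>{1..t}. Fix (F i));
              \<gamma> = onorm (A \<circ> closest_point (orthogonal_comp M))
          in \<gamma> \<in> {0..<1}
           \<and> (\<forall>x k. norm ((CC S ^^ k) x - closest_point M x)
                       \<le> \<gamma> ^ k * norm (x - closest_point M x))
           \<and> (\<forall>x. converges_linearly (\<lambda>k. (CC S ^^ k) x) (closest_point M x) \<gamma>))"
proof -
  define M where "M = (\<Inter>i\<in>{1..t}. Fix (F i))"
  define \<mu> where "\<mu> i = (if i = 1 then 1 else l i)" for i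
  let ?B = "averaged_summand F \<alpha> \<mu>"
  have isom: "linear T \<and> isometry T" if "T \<in> S" for T
    using that assms(2,4) by (intro linear_isometry_compositions[of T "F ` {1..t}"]) auto
  have FixS: "(\<Inter>T\<in>S. Fix T) = M"
    unfolding M_def by (rule Inter_Fix_compositions[OF assms(4,5)])
  have fixed: "T z = z" if "T \<in> S" "z \<in> M" for T z
    using that unfolding FixS[symmetric] Fix_def by auto
  have comp_S: "comp_upto F i \<in> S" if "i \<le> t" for i using assms(5) that by auto
  have id_S: "id \<in> S" using comp_S[of 0] by simp
  have F: "linear (F i) \<and> (\<forall>x. norm (F i x) = norm x)" if "i \<in> {1..t}" for i
    using assms(2)[OF that] linear_0[of "F i"] unfolding isometry_def by (metis diff_zero)
  have \<mu>: "0 < \<mu> i \<and> \<mu> i \<le> 1" if "i \<in> {1..t}" for i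
    using assms(9)[OF that] by (auto simp: \<mu>_def)
  have "A_i i x = ?B i x" if "i \<in> {1..t}" for i x
    using that assms(10,11) by (cases "i = 1") (auto simp: averaged_summand_def \<mu>_def)
  then have A: "A = (\<lambda>x. \<Sum>i=1..t. \<omega> i *\<^sub>R ?B i x)"
    unfolding assms(12) by (intro ext sum.cong) auto
  have lin_B: "linear (?B i)" if "i \<in> {1..t}" for i
  proof -
    have "linear (comp_upto F (i - 1)) \<and> (\<forall>x. norm (comp_upto F (i - 1) x) = norm x)"
      by (rule linear_norm_preserving_comp_upto) (use F that in auto)
    then have G: "linear (comp_upto F (i - 1))" by simp
    moreover have "linear (\<lambda>x. F i (comp_upto F (i - 1) x))"
      using linear_compose[OF G, of "F i"] F[OF that] by (simp add: o_def)
    ultimately show ?thesis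
      unfolding averaged_summand_def[abs_def]
      by (intro linear_compose_add linear_compose_scale_right linear_ident)
  qed
  have lin: "linear A"
    unfolding A using lin_B by (intro linear_compose_sum ballI linear_compose_scale_right) auto
  have hull: "A x \<in> affine hull ((\<lambda>T. T x) ` S)" for x
    unfolding A
  proof (rule convex_sum)
    fix i assume i: "i \<in> {1..t}"
    have mem: "comp_upto F j x \<in> affine hull ((\<lambda>T. T x) ` S)" if "j \<le> t" for j
      using comp_S[OF that] by (intro hull_inc) auto
    have "F i (comp_upto F (i - 1) x) = comp_upto F i x" using i by (cases i) auto
    then show "?B i x \<in> affine hull ((\<lambda>T. T x) ` S)"
      using i mem[of 0] mem[of "i - 1"] mem[of i] assms(8)[OF i] \<mu>[OF i]
      by (intro convex_averaged_summand affine_imp_convex affine_affine_hull) auto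
    show "0 \<le> \<omega> i" using assms(6)[OF i] by simp
  qed (use assms(7) in \<open>auto intro: affine_imp_convex\<close>)
  have expansive: "x \<in> M" if "norm x \<le> norm (A x)" for x
  proof -
    have "F i x = x" if "i \<in> {1..t}" for i
      using averaged_operator_expansive_imp_fixed[of t F \<omega> \<alpha> \<mu> x i] F assms(6-8) \<mu> that
        \<open>norm x \<le> norm (A x)\<close> unfolding A by auto
    then show ?thesis by (auto simp: M_def Fix_def)
  qed
  have FixA: "M = Fix A"
  proof (intro equalityI subsetI)
    fix x assume "x \<in> M"
    have "(\<lambda>T. T x) ` S = {x}"
      using id_S fixed[OF _ \<open>x \<in> M\<close>] by (intro image_common_fixed_point) auto
    then show "x \<in> Fix A" using hull[of x] by (simp add: Fix_def)
  qed (auto intro: expansive simp: Fix_def)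
  have M: "subspace M"
    unfolding FixA Fix_def subspace_def
    by (simp add: linear_0[OF lin] linear_add[OF lin] linear_cmul[OF lin])
  define \<gamma> where "\<gamma> = onorm (A \<circ> closest_point (orthogonal_comp M))"
  have "\<gamma> \<ge> 0"
    unfolding \<gamma>_def
    by (intro onorm_pos_le linear_compose[THEN linear_conv_bounded_linear[THEN iffD1]]
        linear_closest_point_subspace subspace_orthogonal_comp lin)
  moreover have "\<gamma> < 1"
    unfolding \<gamma>_def by (rule onorm_compose_orthogonal_projection_less_1[OF lin expansive])
  ultimately have \<gamma>: "\<gamma> \<in> {0..<1}" by simp
  have bound: "norm ((CC S ^^ k) x - closest_point M x) \<le> \<gamma> ^ k * norm (x - closest_point M x)" for x k
    unfolding \<gamma>_def by (rule norm_CC_funpow_le[OF M _ _ lin hull]) (use isom fixed in blast)+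
  have "converges_linearly (\<lambda>k. (CC S ^^ k) x) (closest_point M x) \<gamma>" for x
  proof -
    have "(\<lambda>k. \<gamma> ^ k * norm (x - closest_point M x)) \<longlonglongrightarrow> 0"
      using \<gamma> by (intro tendsto_mult_left_zero LIMSEQ_realpow_zero) auto
    then have "(\<lambda>k. (CC S ^^ k) x - closest_point M x) \<longlonglongrightarrow> 0"
      by (rule Lim_null_comparison[rotated]) (simp add: bound)
    then show ?thesis
      using \<gamma> bound[of _ x] unfolding converges_linearly_def LIM_zero_iff
      by (auto intro!: exI[of _ "norm (x - closest_point M x)"] simp: mult.commute)
  qed
  moreover have "Fix (CC S) = (\<Inter>T\<in>S. Fix T)"
    by (rule Fix_CC[where z = 0]) (use id_S isom fixed[OF _ subspace_0[OF M]] in blast)+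
  ultimately show ?thesis
    using FixS FixA \<gamma> bound unfolding Let_def M_def[symmetric] \<gamma>_def[symmetric] by blast
qed

end
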